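(* No two-sided frieze type whose label is of the form $\mathrm{p}2\ast\ast$ or $\mathrm{p}{\ast}2\ast$ (that is, with the symbol $2$, alone or stacked with another symbol, in the second position or in the third position) can be realised in hitomezashi. That is, none of the types $\mathrm{p2mm}$, $\mathrm{pm2m}$, $\mathrm{p2aa}$, $\mathrm{p211}$, $\mathrm{p222}$, $\mathrm{p}\stackrel{2}{\mathrm m}11$, $\mathrm{p121}$, $\mathrm{p}2'22$, $\mathrm{p}1\stackrel{2}{\mathrm m}1$, $\mathrm{p}1\stackrel{2}{\mathrm a}1$, $\mathrm{pm2a}$ is the type of any hitomezashi two-sided frieze.
   Context: **Hitomezashi two-sided friezes.** Let $x=(x_i)_{i\in\mathbb Z}$ be a periodic bi-infinite binary sequence (given by indefinite repetition of a finite binary word), and let $y=y_1\cdots y_n$ be a finite binary word with $n=|y|\ge 2$. The grid edges of the strip are the vertical unit edges from $(i,j)$ to $(i,j+1)$ for $i\in\mathbb Z$, $1\le j\le n-1$, and the horizontal unit edges from $(i,j)$ to $(i+1,j)$ for $i\in\mathbb Z$, $1\le j\le n$. Stitches and gaps alternate along each line. On the front, the vertical edge from $(i,j)$ to $(i,j+1)$ carries a stitch iff ($x_i=1$ and $j$ odd) or ($x_i=0$ and $j$ even); the horizontal edge from $(i,j)$ to $(i+1,j)$ carries a stitch iff ($y_j=1$ and $i$ even) or ($y_j=0$ and $i$ odd). Let $F$ be the set of edges carrying a stitch on the front. On the back, a stitch lies behind each gap of the front and a gap behind each stitch, so the set $B$ of edges stitched on the back (in the same planar coordinates) is the complement of $F$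 in the set of all grid edges. The pair $(F,B)$ is the hitomezashi two-sided frieze given by $x,y$. **Symmetries.** Axis $\mathbf a$ is the horizontal central line of the strip in the frieze plane, $\mathbf b$ is perpendicular to $\mathbf a$ in the frieze plane, and $\mathbf c$ is perpendicular to the frieze plane. A candidate isometry is a quadruple $(s,t,e,d)$ with $s,e,d\in\{+1,-1\}$, $t\in\mathbb R$. It acts on the plane by $X\mapsto sX+t$ on the horizontal coordinate, fixes the vertical coordinate if $e=+1$, sends it to $Y\mapsto n+1-Y$ if $e=-1$, and keeps the two sides if $d=+1$ or exchanges them if $d=-1$. It is a symmetry of $(F,B)$ if its planar action maps $F$ to $F$ and $B$ to $B$ (case $d=+1$), or $F$ to $B$ and $B$ to $F$ (case $d=-1$). The symmetries form a group $G$, whose pure translations $(+1,t,+1,+1)$ are those with $t\in T\mathbb Z$ for some $T>0$. **Labels.** A two-sided frieze type has a label $\mathrm{p}\ast\ast\ast$ whose second, third and fourth positions describe symmetry relative to $\mathbf a$, $\mathbf b$, $\mathbf c$ respectively. Symbols: $1$ is a placeholder; $\mathrm m$ is reflection in a plane perpendicular to the axis; $\mathrm a$ is glide reflection, the reflection being in a plane perpendicular to the axis and the glide parallel to $\mathbf a$; $2$ is rotation by $180^\circ$ about the axis (for $\mathbf b$, $\mathbf c$: about some line parallel to it meeting $\mathbf a$); $2'$ (second position only; a different symbol from $2$) is a screw, i.e. $180^\circ$ rotation about $\mathbf a$ together with a translation parallel to $\mathbf a$; $\tilde 2$ (fourth position only) is roto-reflection, i.e. $180^\circ$ rotation about a line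 parallel to $\mathbf c$ together with reflection in the frieze plane. Two symbols applying to the same axis are stacked. In terms of quadruples, the symbols in the various positions are: second position: $\mathrm m=(-1,t,+,+)$, $2=(+1,0,-,-)$, $2'=(+1,T/2,-,-)$; third position: $\mathrm m=(+1,0,-,+)$, $\mathrm a=(+1,T/2,-,+)$, $2=(-1,t,+,-)$; fourth position: $\mathrm m=(+1,0,+,-)$, $\mathrm a=(+1,T/2,+,-)$, $2=(-1,t,-,+)$, $\tilde 2=(-1,t,-,-)$ (with $t$ some real number). A frieze is of the type with a given label if $G$ is generated by its translations and symmetries of the kinds shown by the symbols in the label. If several symbols with $s=-1$ appear, they arise from one another by composition with elements with $s=+1$, so only one of them together with the symbols with $s=+1$ need be taken as generators. The 31 types are: $\mathrm{p111}$, $\mathrm{pm11}$, $\mathrm{p112}$, $\mathrm{p121}$, $\mathrm{p}11\tilde2$, $\mathrm{p1m1}$, $\mathrm{pmm2}$, $\mathrm{p}1\stackrel{2}{\mathrm m}1$, $\mathrm{p1a1}$, $\mathrm{pma2}$, $\mathrm{p}1\stackrel{2}{\mathrm a}1$, $\mathrm{p11m}$, $\mathrm{pm2m}$, $\mathrm{p}11\stackrel{2}{\mathrm m}$, $\mathrm{p11a}$, $\mathrm{pm2a}$, $\mathrm{p}11\stackrel{2}{\mathrm a}$, $\mathrm{p211}$, $\mathrm{p}\stackrel{2}{\mathrm m}11$, $\mathrm{p222}$, $\mathrm{p}2'11$, $\mathrm{p}\stackrel{2'}{\mathrm m}11$, $\mathrm{p}2'22$, $\mathrm{p2mm}$, $\mathrm{pmmm}$,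 $\mathrm{p}2'\mathrm{am}$, $\mathrm{pmam}$, $\mathrm{p}2'\mathrm{ma}$, $\mathrm{pmma}$, $\mathrm{p2aa}$, $\mathrm{pmaa}$ (in $\mathrm{pmmm}$, $\mathrm{pmam}$, $\mathrm{pmma}$, $\mathrm{pmaa}$ the three displayed symbols generate, with the translations, the whole group). A type is realised in hitomezashi if some hitomezashi two-sided frieze is of that type. *)

theory Defs
  imports "HOL-Analysis.Analysis" "HOL-Algebra.Generated_Groups"
begin

section \<open>Two-sided hitomezashi friezes\<close>

text \<open>Binary digits are Booleans (True for 1, False for 0). The letter $y_j$ of a word, with
  $1 \le j \le n$, is \<open>y ! (j - 1)\<close>. Edges are closed unit segments in the plane.\<close>

definition periodic :: "(int \<Rightarrow> bool) \<Rightarrow> bool" where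
  "periodic x \<longleftrightarrow> (\<exists>p::nat. p > 0 \<and> (\<forall>i. x (i + int p) = x i))"

definition v_edge :: "int \<Rightarrow> nat \<Rightarrow> (real \<times> real) set" where
  "v_edge i j = closed_segment (real_of_int i, real j) (real_of_int i, real j + 1)"

definition h_edge :: "int \<Rightarrow> nat \<Rightarrow> (real \<times> real) set" where
  "h_edge i j = closed_segment (real_of_int i, real j) (real_of_int i + 1, real j)"

definition grid_edges :: "nat \<Rightarrow> (real \<times> real) set set" where
  "grid_edges n = {v_edge i j | i j. 1 \<le> j \<and> j < n} \<union> {h_edge i j | i j. 1 \<le> j \<and> j \<le> n}"

definition front_stitches :: "(int \<Rightarrow> bool) \<Rightarrow> bool list \<Rightarrow> (real \<times> real) set set" where
  "front_stitches x y =
     {v_edge i j | i j. 1 \<le> j \<and> j < length y \<and> (x i \<and> odd j \<or> \<not> x i \<and> even j)} \<union>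
     {h_edge i j | i j. 1 \<le> j \<and> j \<le> length y \<and>
        (y ! (j - 1) \<and> even i \<or> \<not> y ! (j - 1) \<and> odd i)}"

definition back_stitches :: "(int \<Rightarrow> bool) \<Rightarrow> bool list \<Rightarrow> (real \<times> real) set set" where
  "back_stitches x y = grid_edges (length y) - front_stitches x y"


section \<open>Symmetries\<close>

text \<open>A quadruple \<open>(s, t, e, d)\<close> consists of the direction \<open>s\<close> and offset \<open>t\<close> of the horizontal
  action, the vertical sign \<open>e\<close>, and the sign \<open>d\<close> recording whether the two sides are kept
  or exchanged.\<close>

type_synonym isometry = "int \<times> real \<times> int \<times> int"

text \<open>The product is composition of maps, the right factor acting first.\<close>

definition isometries :: "isometry monoid" where
  "isometries =
     \<lparr>carrier = {1, -1} \<times> UNIV \<times> {1, -1} \<times> {1, -1},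
      monoid.mult = (\<lambda>(s, t, e, d) (s', t', e', d'). (s * s', of_int s * t' + t, e * e', d * d')),
      one = (1, 0, 1, 1)\<rparr>"

fun planar_action :: "nat \<Rightarrow> isometry \<Rightarrow> real \<times> real \<Rightarrow> real \<times> real" where
  "planar_action n (s, t, e, d) (X, Y) =
     (of_int s * X + t, if e = 1 then Y else real n + 1 - Y)"

fun keeps_sides :: "isometry \<Rightarrow> bool" where
  "keeps_sides (s, t, e, d) \<longleftrightarrow> d = 1"

definition symmetries :: "(int \<Rightarrow> bool) \<Rightarrow> bool list \<Rightarrow> isometry set" where
  "symmetries x y = {g \<in> carrier isometries.
     let act = (\<lambda>E. (`) (planar_action (length y) g) ` E) in
     if keeps_sides g
     then act (front_stitches x y) = front_stitches x y \<and> act (back_stitches x y) = back_stitches x y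
     else act (front_stitches x y) = back_stitches x y \<and> act (back_stitches x y) = front_stitches x y}"

definition pure_translations :: "isometry set \<Rightarrow> isometry set" where
  "pure_translations G = {g \<in> G. \<exists>t. g = (1, t, 1, 1)}"


section \<open>Frieze types\<close>

text \<open>The symbols that can occur in the positions for the axes $a$, $b$, $c$ are, in order:
  $m$, $2$, $2'$; $m$, $a$, $2$; and $m$, $a$, $2$, $\tilde 2$.\<close>

datatype symbol_a = Mirror_a | Rot_a | Screw_a
datatype symbol_b = Mirror_b | Glide_b | Rot_b
datatype symbol_c = Mirror_c | Glide_c | Rot_c | Rotorefl_c

text \<open>Each position holds a set of symbols: empty for the placeholder 1, with two elements
  for stacked symbols.\<close>

datatype label = P (pos_a: "symbol_a set") (pos_b: "symbol_b set") (pos_c: "symbol_c set")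

text \<open>The isometries shown by a symbol, where \<open>T\<close> is the generating translation length.\<close>

fun kind_a :: "real \<Rightarrow> symbol_a \<Rightarrow> isometry set" where
  "kind_a T Mirror_a = {(-1, t, 1, 1) | t. True}"
| "kind_a T Rot_a = {(1, 0, -1, -1)}"
| "kind_a T Screw_a = {(1, T / 2, -1, -1)}"

fun kind_b :: "real \<Rightarrow> symbol_b \<Rightarrow> isometry set" where
  "kind_b T Mirror_b = {(1, 0, -1, 1)}"
| "kind_b T Glide_b = {(1, T / 2, -1, 1)}"
| "kind_b T Rot_b = {(-1, t, 1, -1) | t. True}"

fun kind_c :: "real \<Rightarrow> symbol_c \<Rightarrow> isometry set" where
  "kind_c T Mirror_c = {(1, 0, 1, -1)}"
| "kind_c T Glide_c = {(1, T / 2, 1, -1)}"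
| "kind_c T Rot_c = {(-1, t, -1, 1) | t. True}"
| "kind_c T Rotorefl_c = {(-1, t, -1, -1) | t. True}"

definition kinds :: "real \<Rightarrow> label \<Rightarrow> isometry set set" where
  "kinds T L = kind_a T ` pos_a L \<union> kind_b T ` pos_b L \<union> kind_c T ` pos_c L"

text \<open>Every symbol of the label must be shown by some symmetry. Two symmetries in the same kind
  differ by a translation of the group, so taking all of them as generators is the same as
  taking one for each symbol.\<close>

definition of_type :: "isometry set \<Rightarrow> label \<Rightarrow> bool" where
  "of_type G L \<longleftrightarrow> (\<exists>T>0.
     pure_translations G = {(1, of_int k * T, 1, 1) | k::int. True} \<and>
     (\<forall>K \<in> kinds T L. K \<inter> G \<noteq> {}) \<and>
     G = generate isometries (pure_translations G \<union> (\<Union>(kinds T L) \<inter> G)))"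

definition two_sided_types :: "label set" where
  "two_sided_types = {
     P {} {} {},
     P {Mirror_a} {} {},
     P {} {} {Rot_c},
     P {} {Rot_b} {},
     P {} {} {Rotorefl_c},
     P {} {Mirror_b} {},
     P {Mirror_a} {Mirror_b} {Rot_c},
     P {} {Mirror_b, Rot_b} {},
     P {} {Glide_b} {},
     P {Mirror_a} {Glide_b} {Rot_c},
     P {} {Glide_b, Rot_b} {},
     P {} {} {Mirror_c},
     P {Mirror_a} {Rot_b} {Mirror_c},
     P {} {} {Mirror_c, Rot_c},
     P {} {} {Glide_c},
     P {Mirror_a} {Rot_b} {Glide_c},
     P {} {} {Glide_c, Rot_c},
     P {Rot_a} {} {},
     P {Mirror_a, Rot_a} {} {},
     P {Rot_a} {Rot_b} {Rot_c},
     P {Screw_a} {} {},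
     P {Mirror_a, Screw_a} {} {},
     P {Screw_a} {Rot_b} {Rot_c},
     P {Rot_a} {Mirror_b} {Mirror_c},
     P {Mirror_a} {Mirror_b} {Mirror_c},
     P {Screw_a} {Glide_b} {Mirror_c},
     P {Mirror_a} {Glide_b} {Mirror_c},
     P {Screw_a} {Mirror_b} {Glide_c},
     P {Mirror_a} {Mirror_b} {Glide_c},
     P {Rot_a} {Glide_b} {Glide_c},
     P {Mirror_a} {Glide_b} {Glide_c}}"

definition realised_in_hitomezashi :: "label \<Rightarrow> bool" where
  "realised_in_hitomezashi L \<longleftrightarrow>
     (\<exists>x y. periodic x \<and> length y \<ge> 2 \<and> of_type (symmetries x y) L)"


section \<open>Sanity checks\<close>

lemma card_two_sided_types: "card two_sided_types = 31"
  by code_simp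

lemma types_with_2:
  "{L \<in> two_sided_types. Rot_a \<in> pos_a L \<or> Rot_b \<in> pos_b L} =
   {P {Rot_a} {Mirror_b} {Mirror_c}, P {Mirror_a} {Rot_b} {Mirror_c},
    P {Rot_a} {Glide_b} {Glide_c}, P {Rot_a} {} {}, P {Rot_a} {Rot_b} {Rot_c},
    P {Mirror_a, Rot_a} {} {}, P {} {Rot_b} {}, P {Screw_a} {Rot_b} {Rot_c},
    P {} {Mirror_b, Rot_b} {}, P {} {Glide_b, Rot_b} {}, P {Mirror_a} {Rot_b} {Glide_c}}"
  by code_simp

lemma isometries_simps:
  "(s, t, e, d) \<in> carrier isometries \<longleftrightarrow> s \<in> {1,-1} \<and> e \<in> {1,-1} \<and> d \<in> {1,-1}"
  "(s, t, e, d) \<otimes>\<^bsub>isometries\<^esub> (s', t', e', d') = (s * s', of_int s * t' + t, e * e', d * d')"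
  "\<one>\<^bsub>isometries\<^esub> = (1, 0, 1, 1)"
  by (auto simp: isometries_def)

lemma sign_mult: "(a::int) \<in> {1,-1} \<Longrightarrow> b \<in> {1,-1} \<Longrightarrow> a * b \<in> {1,-1}"
  by auto

lemma group_isometries: "group isometries"
proof (rule groupI)
  show "g \<otimes>\<^bsub>isometries\<^esub> h \<in> carrier isometries"
    if "g \<in> carrier isometries" "h \<in> carrier isometries" for g h
    using that by (cases g; cases h) (simp only: isometries_simps sign_mult simp_thms)
  show "g \<otimes>\<^bsub>isometries\<^esub> h \<otimes>\<^bsub>isometries\<^esub> k = g \<otimes>\<^bsub>isometries\<^esub> (h \<otimes>\<^bsub>isometries\<^esub> k)" for g h k
    by (cases g; cases h; cases k) (simp add: isometries_simps algebra_simps)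
  show "\<one>\<^bsub>isometries\<^esub> \<in> carrier isometries" by (simp add: isometries_simps)
  show "\<one>\<^bsub>isometries\<^esub> \<otimes>\<^bsub>isometries\<^esub> g = g" for g
    by (cases g) (simp add: isometries_simps)
  fix g assume "g \<in> carrier isometries"
  then obtain s t e d where g: "g = (s, t, e, d)" "s \<in> {1,-1}" "e \<in> {1,-1}" "d \<in> {1,-1}"
    by (cases g) (simp only: isometries_simps)
  have "(s, - of_int s * t, e, d) \<in> carrier isometries"
    "(s, - of_int s * t, e, d) \<otimes>\<^bsub>isometries\<^esub> g = \<one>\<^bsub>isometries\<^esub>"
    using g by (auto simp: isometries_simps)
  then show "\<exists>h\<in>carrier isometries. h \<otimes>\<^bsub>isometries\<^esub> g = \<one>\<^bsub>isometries\<^esub>" by blast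
qed

lemma planar_action_mult:
  assumes "g \<in> carrier isometries" "h \<in> carrier isometries"
  shows "planar_action n (g \<otimes>\<^bsub>isometries\<^esub> h) = planar_action n g \<circ> planar_action n h"
  using assms by (cases g; cases h) (auto simp: isometries_simps fun_eq_iff algebra_simps)

lemma planar_action_one: "planar_action n \<one>\<^bsub>isometries\<^esub> = id"
  by (auto simp: isometries_def fun_eq_iff)

lemma keeps_sides_mult:
  assumes "g \<in> carrier isometries" "h \<in> carrier isometries"
  shows "keeps_sides (g \<otimes>\<^bsub>isometries\<^esub> h) \<longleftrightarrow> (keeps_sides g \<longleftrightarrow> keeps_sides h)"
  using assms by (cases g; cases h) (auto simp: isometries_simps)

lemma subgroup_symmetries: "subgroup (symmetries x y) isometries"
proof -
  interpret group isometries by (rule group_isometries)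
  define A where "A g E = (`) (planar_action (length y) g) ` E" for g and E :: "(real \<times> real) set set"
  have sym: "g \<in> symmetries x y \<longleftrightarrow> g \<in> carrier isometries \<and>
      (if keeps_sides g then A g (front_stitches x y) = front_stitches x y \<and> A g (back_stitches x y) = back_stitches x y
       else A g (front_stitches x y) = back_stitches x y \<and> A g (back_stitches x y) = front_stitches x y)" for g
    by (auto simp: symmetries_def A_def Let_def)
  have A_mult: "A (g \<otimes>\<^bsub>isometries\<^esub> h) E = A g (A h E)"
    if "g \<in> carrier isometries" "h \<in> carrier isometries" for g h E
    unfolding A_def planar_action_mult[OF that] by (simp add: image_image image_comp)
  have A_one: "A \<one>\<^bsub>isometries\<^esub> E = E" for E
    by (simp add: A_def planar_action_one)
  have one: "keeps_sides \<one>\<^bsub>isometries\<^esub>" by (simp add: isometries_def)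
  show ?thesis
  proof (rule subgroupI)
    show "symmetries x y \<subseteq> carrier isometries" by (auto simp: sym)
    show "symmetries x y \<noteq> {}" using sym[of "\<one>\<^bsub>isometries\<^esub>"] A_one one by auto
    show "g \<otimes>\<^bsub>isometries\<^esub> h \<in> symmetries x y"
      if "g \<in> symmetries x y" "h \<in> symmetries x y" for g h
    proof -
      have c: "g \<in> carrier isometries" "h \<in> carrier isometries" using that sym by blast+
      show ?thesis using that unfolding sym A_mult[OF c] keeps_sides_mult[OF c]
        by (auto split: if_splits)
    qed
    show "inv\<^bsub>isometries\<^esub> g \<in> symmetries x y" if g: "g \<in> symmetries x y" for g
    proof -
      have c: "g \<in> carrier isometries" "inv\<^bsub>isometries\<^esub> g \<in> carrier isometries"
        using g sym inv_closed by blast+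
      have k: "keeps_sides (inv\<^bsub>isometries\<^esub> g) = keeps_sides g"
        using keeps_sides_mult[OF c(2,1)] one l_inv[OF c(1)] by simp
      have i: "A (inv\<^bsub>isometries\<^esub> g) (A g E) = E" for E
        using A_mult[OF c(2,1)] l_inv[OF c(1)] A_one by simp
      show ?thesis using g i[of "front_stitches x y"] i[of "back_stitches x y"] c(2) unfolding sym k
        by (auto split: if_splits)
    qed
  qed
qed

end

theory Submission
  imports Defs
begin

text \<open>
  Every grid edge is stitched on exactly one side of the fabric, so a symmetry that exchanges the two
  sides cannot map any grid edge to itself: the edge would have to be stitched on
  both sides or on neither (\<open>side_exchange_fixes_no_edge\<close>).

  The symbol 2 in the second position exchanges the sides and reflects the strip in its central
  line. That line either lies along a row of horizontal edges or bisects a row of vertical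
  edges, according to the parity of the width \<open>n\<close>, so some edge is fixed
  (\<open>rot_a_not_symmetry\<close>). The symbol 2 in the third position exchanges the sides and reflects
  the strip in a line perpendicular to the central line. Because vertical edges have to land on
  vertical edges, this line either runs through grid vertices or bisects horizontal edges, so
  again some edge is fixed (\<open>rot_b_not_symmetry\<close>). A type with either symbol requires
  such a symmetry.
\<close>

lemma v_edge_eq: "v_edge i j = {real_of_int i} \<times> {real j..real j + 1}"
proof -
  have "closed_segment (real_of_int i, real j) (real_of_int i, real j + 1)
      = Pair (real_of_int i) ` closed_segment (real j) (real j + 1)"
    by (auto simp: in_segment image_iff algebra_simps)
  then show ?thesis
    by (auto simp: v_edge_def closed_segment_eq_real_ivl)
qed

lemma h_edge_eq: "h_edge i j = {real_of_int i..real_of_int i + 1} \<times> {real j}"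
proof -
  have "closed_segment (real_of_int i, real j) (real_of_int i + 1, real j)
      = (\<lambda>X. (X, real j)) ` closed_segment (real_of_int i) (real_of_int i + 1)"
    by (auto simp: in_segment image_iff algebra_simps)
  then show ?thesis
    by (auto simp: h_edge_def closed_segment_eq_real_ivl)
qed

lemma v_edge_in_grid: "1 \<le> j \<Longrightarrow> j < n \<Longrightarrow> v_edge i j \<in> grid_edges n"
  by (auto simp: grid_edges_def)

lemma h_edge_in_grid: "1 \<le> j \<Longrightarrow> j \<le> n \<Longrightarrow> h_edge i j \<in> grid_edges n"
  by (auto simp: grid_edges_def)

lemma image_eq_if_involution:
  assumes "\<And>p. f (f p) = p" "\<And>p. p \<in> E \<Longrightarrow> f p \<in> E"
  shows "f ` E = E"
  using assms by (metis image_subsetI imageI subset_antisym subsetI)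

lemma front_stitches_subset_grid: "front_stitches x y \<subseteq> grid_edges (length y)"
  by (auto simp: front_stitches_def grid_edges_def)

lemma symmetry_preserves_grid:
  assumes "g \<in> symmetries x y" "E \<in> grid_edges (length y)"
  shows "planar_action (length y) g ` E \<in> grid_edges (length y)"
proof -
  have "E \<in> front_stitches x y \<or> E \<in> back_stitches x y"
    using assms(2) by (auto simp: back_stitches_def)
  moreover have "front_stitches x y \<subseteq> grid_edges (length y)"
    "back_stitches x y \<subseteq> grid_edges (length y)"
    using front_stitches_subset_grid by (auto simp: back_stitches_def)
  ultimately show ?thesis
    using assms(1) unfolding symmetries_def Let_def
    by (auto split: if_splits)
qed

lemma side_exchange_fixes_no_edge:
  assumes "g \<in> symmetries x y" "\<not> keeps_sides g" "E \<in> grid_edges (length y)"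
  shows "planar_action (length y) g ` E \<noteq> E"
proof
  assume fixed: "planar_action (length y) g ` E = E"
  have "(`) (planar_action (length y) g) ` front_stitches x y = back_stitches x y"
    "(`) (planar_action (length y) g) ` back_stitches x y = front_stitches x y"
    using assms(1,2) by (auto simp: symmetries_def Let_def)
  then have "E \<in> front_stitches x y \<longleftrightarrow> E \<in> back_stitches x y"
    using fixed by (metis imageI)
  then show False
    using assms(3) by (simp add: back_stitches_def)
qed

lemma rot_a_not_symmetry:
  assumes "length y \<ge> 2"
  shows "(1, 0, -1, -1) \<notin> symmetries x y"
proof
  let ?n = "length y"
  let ?f = "planar_action ?n (1, 0, -1, -1)"
  assume sym: "(1, 0, -1, -1) \<in> symmetries x y"
  have invol: "?f (?f p) = p" for p
    by (cases p) simp
  show False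
  proof (cases "even ?n")
    case True
    \<comment> \<open>The central line bisects the vertical edges from height \<open>k\<close> to height \<open>k + 1\<close>.\<close>
    then obtain k where k: "?n = 2 * k" by blast
    have "?f ` v_edge 0 k = v_edge 0 k"
      by (rule image_eq_if_involution[OF invol]) (auto simp: v_edge_eq k)
    moreover have "v_edge 0 k \<in> grid_edges ?n"
      using assms k by (intro v_edge_in_grid) auto
    ultimately show False
      using side_exchange_fixes_no_edge[OF sym] by simp
  next
    case False
    \<comment> \<open>The central line is the row of horizontal edges at height \<open>k + 1\<close>.\<close>
    then obtain k where k: "?n = 2 * k + 1" by (blast elim: oddE)
    have "?f ` h_edge 0 (k + 1) = h_edge 0 (k + 1)"
      by (rule image_eq_if_involution[OF invol]) (auto simp: h_edge_eq k)
    moreover have "h_edge 0 (k + 1) \<in> grid_edges ?n"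
      using k by (intro h_edge_in_grid) auto
    ultimately show False
      using side_exchange_fixes_no_edge[OF sym] by simp
  qed
qed

text \<open>The midpoint of a vertical edge lies on no horizontal line of the grid, so its image, which
  has the same height, lies on a vertical one.\<close>

lemma reflection_symmetry_offset_int:
  assumes "length y \<ge> 2" "(-1, t, 1, d) \<in> symmetries x y"
  shows "\<exists>m::int. t = real_of_int m"
proof -
  let ?f = "planar_action (length y) (-1, t, 1, d)"
  have "?f ` v_edge 0 1 \<in> grid_edges (length y)"
    using assms by (intro symmetry_preserves_grid v_edge_in_grid) auto
  moreover have "(t, 3/2) \<in> ?f ` v_edge 0 1"
    by (rule image_eqI[of _ _ "(0, 3/2)"]) (auto simp: v_edge_eq)
  ultimately obtain E where E: "E \<in> grid_edges (length y)" "(t, 3/2) \<in> E"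
    by blast
  have no_row: "(3/2::real) \<noteq> real j" for j
  proof
    assume "3/2 = real j"
    then have "real 3 = real (2 * j)" by simp
    then have "3 = 2 * j" using of_nat_eq_iff by blast
    then show False by presburger
  qed
  show ?thesis
    using E no_row by (auto simp: grid_edges_def v_edge_eq h_edge_eq simp del: divide_eq_eq_numeral1)
qed

lemma rot_b_not_symmetry:
  assumes "length y \<ge> 2"
  shows "(-1, t, 1, -1) \<notin> symmetries x y"
proof
  let ?n = "length y"
  let ?f = "planar_action ?n (-1, t, 1, -1)"
  assume sym: "(-1, t, 1, -1) \<in> symmetries x y"
  have invol: "?f (?f p) = p" for p
    by (cases p) simp
  obtain m where t: "t = real_of_int m"
    using reflection_symmetry_offset_int[OF assms sym] by blast
  \<comment> \<open>The axis is the line \<open>X = t / 2\<close>.\<close>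
  show False
  proof (cases "even m")
    case True
    then obtain k where k: "m = 2 * k" by blast
    have "?f ` v_edge k 1 = v_edge k 1"
      by (rule image_eq_if_involution[OF invol]) (auto simp: v_edge_eq t k)
    moreover have "v_edge k 1 \<in> grid_edges ?n"
      using assms by (intro v_edge_in_grid) auto
    ultimately show False
      using side_exchange_fixes_no_edge[OF sym] by simp
  next
    case False
    then obtain k where k: "m = 2 * k + 1" by (blast elim: oddE)
    have "?f ` h_edge k 1 = h_edge k 1"
      by (rule image_eq_if_involution[OF invol]) (auto simp: h_edge_eq t k)
    moreover have "h_edge k 1 \<in> grid_edges ?n"
      using assms by (intro h_edge_in_grid) auto
    ultimately show False
      using side_exchange_fixes_no_edge[OF sym] by simp
  qed
qed

lemma label_with_2_not_realised:
  assumes "Rot_a \<in> pos_a L \<or> Rot_b \<in> pos_b L"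
  shows "\<not> realised_in_hitomezashi L"
proof
  assume "realised_in_hitomezashi L"
  then obtain x y T where n: "length y \<ge> 2"
    and shown: "\<forall>K \<in> kinds T L. K \<inter> symmetries x y \<noteq> {}"
    by (auto simp: realised_in_hitomezashi_def of_type_def)
  from assms have "kind_a T Rot_a \<in> kinds T L \<or> kind_b T Rot_b \<in> kinds T L"
    by (auto simp: kinds_def simp del: kind_a.simps kind_b.simps)
  then have "kind_a T Rot_a \<inter> symmetries x y \<noteq> {} \<or> kind_b T Rot_b \<inter> symmetries x y \<noteq> {}"
    using shown by blast
  then show False
    using rot_a_not_symmetry[OF n] rot_b_not_symmetry[OF n] by auto
qed

theorem theorem2:
  "(\<forall>L \<in> two_sided_types.
      Rot_a \<in> pos_a L \<or> Rot_b \<in> pos_b L \<longrightarrow> \<not> realised_in_hitomezashi L) \<and>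
   (\<forall>L \<in> {P {Rot_a} {Mirror_b} {Mirror_c}, P {Mirror_a} {Rot_b} {Mirror_c},
           P {Rot_a} {Glide_b} {Glide_c}, P {Rot_a} {} {}, P {Rot_a} {Rot_b} {Rot_c},
           P {Mirror_a, Rot_a} {} {}, P {} {Rot_b} {}, P {Screw_a} {Rot_b} {Rot_c},
           P {} {Mirror_b, Rot_b} {}, P {} {Glide_b, Rot_b} {},
           P {Mirror_a} {Rot_b} {Glide_c}}.
      \<not> realised_in_hitomezashi L)"
  using label_with_2_not_realised by auto

end
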